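(* Let $G$ be a countable group acting ergodically by measure preserving bijections on a standard probability space $(X,\mu)$. If this action admits a generating partition $\alpha$ having finite Shannon entropy, $\mathrm{H}(\alpha)<\infty$, then it admits a finite generating partition (a generating partition with finitely many classes).
   Context: Partitions of $X$ are partitions into measurable sets. For a partition $\alpha$ of $X$, $G\cdot\alpha$ denotes the smallest $\sigma$-algebra containing all the sets $g\cdot A$ for $g\in G$ and $A\in\alpha$. The partition $\alpha$ is generating (a generator) if for every measurable set $B\subseteq X$ there is some $B'\in G\cdot\alpha$ with $\mu(B\triangle B')=0$. The Shannon entropy of a partition $\alpha$ is $\mathrm{H}(\alpha)=\sum_{A\in\alpha^*}-\mu(A)\log(\mu(A))$ (with $0\log 0=0$) if there is a countable subcollection $\alpha^*\subseteq\alpha$ with $\mu(\bigcup\alpha^* )=1$, and $\mathrm{H}(\alpha)=\infty$ otherwise. *)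

theory Defs
  imports "HOL-Probability.Probability" "HOL-Algebra.Group_Action"
begin

text \<open>The topology is a witness only: a standard Borel space remembers just its
  Borel \<open>\<sigma>\<close>-algebra.\<close>

definition standard_borel_space :: "'a measure \<Rightarrow> bool" where
  "standard_borel_space M \<longleftrightarrow>
     (\<exists>T. completely_metrizable_space T \<and> separable_space T \<and> topspace T = space M \<and>
          sets M = sigma_sets (topspace T) {U. openin T U})"

definition standard_probability_space :: "'a measure \<Rightarrow> bool" where
  "standard_probability_space M \<longleftrightarrow> standard_borel_space M \<and> prob_space M"

text \<open>\<^const>\<open>group_action\<close> makes each \<open>\<phi> g\<close> a bijection of the underlying set. Since \<open>\<phi> (inv g)\<close> is
  measurable too, the bijections are bimeasurable.\<close>

locale pmp_action = group_action G "space M" \<phi>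
  for G (structure) and M :: "'a measure" and \<phi> +
  assumes standard: "standard_probability_space M"
    and measurable_action: "g \<in> carrier G \<Longrightarrow> \<phi> g \<in> measurable M M"
    and measure_preserving:
      "g \<in> carrier G \<Longrightarrow> A \<in> sets M \<Longrightarrow> emeasure M (\<phi> g -` A \<inter> space M) = emeasure M A"

locale ergodic_pmp_action = pmp_action +
  assumes ergodic:
    "A \<in> sets M \<Longrightarrow> (\<And>g. g \<in> carrier G \<Longrightarrow> \<phi> g ` A = A) \<Longrightarrow>
     measure M A = 0 \<or> measure M A = 1"

definition measurable_partition :: "'a measure \<Rightarrow> 'a set set \<Rightarrow> bool" where
  "measurable_partition M \<alpha> \<longleftrightarrow> partition_on (space M) \<alpha> \<and> \<alpha> \<subseteq> sets M"

definition translates_algebra ::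
  "('g, 'b) monoid_scheme \<Rightarrow> 'a measure \<Rightarrow> ('g \<Rightarrow> 'a \<Rightarrow> 'a) \<Rightarrow> 'a set set \<Rightarrow> 'a set set" where
  "translates_algebra G M \<phi> \<alpha> =
     sigma_sets (space M) {\<phi> g ` A | g A. g \<in> carrier G \<and> A \<in> \<alpha>}"

definition generating_partition ::
  "('g, 'b) monoid_scheme \<Rightarrow> 'a measure \<Rightarrow> ('g \<Rightarrow> 'a \<Rightarrow> 'a) \<Rightarrow> 'a set set \<Rightarrow> bool" where
  "generating_partition G M \<phi> \<alpha> \<longleftrightarrow>
     measurable_partition M \<alpha> \<and>
     (\<forall>B\<in>sets M. \<exists>B'\<in>translates_algebra G M \<phi> \<alpha>. emeasure M (sym_diff B B') = 0)"

definition conull_subcollection :: "'a measure \<Rightarrow> 'a set set \<Rightarrow> 'a set set \<Rightarrow> bool" where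
  "conull_subcollection M \<alpha> \<beta> \<longleftrightarrow> countable \<beta> \<and> \<beta> \<subseteq> \<alpha> \<and> measure M (\<Union>\<beta>) = 1"

text \<open>Entropy is in nats; the convention \<open>0 log 0 = 0\<close> holds automatically.\<close>

definition shannon_entropy :: "'a measure \<Rightarrow> 'a set set \<Rightarrow> ennreal" where
  "shannon_entropy M \<alpha> =
     (if \<exists>\<beta>. conull_subcollection M \<alpha> \<beta>
      then \<Sum>\<^sub>\<infinity>A\<in>(SOME \<beta>. conull_subcollection M \<alpha> \<beta>). ennreal (- measure M A * ln (measure M A))
      else \<infinity>)"

text \<open>The choice in the definition is immaterial.\<close>

lemma conull_subcollection_null:
  assumes "prob_space M" "measurable_partition M \<alpha>" "conull_subcollection M \<alpha> \<beta>"
    and "A \<in> \<alpha>" "A \<notin> \<beta>"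
  shows "measure M A = 0"
proof -
  interpret prob_space M by fact
  have sets: "\<alpha> \<subseteq> sets M" and part: "partition_on (space M) \<alpha>"
    using assms(2) by (auto simp: measurable_partition_def)
  have \<beta>: "countable \<beta>" "\<beta> \<subseteq> \<alpha>" "prob (\<Union>\<beta>) = 1"
    using assms(3) by (auto simp: conull_subcollection_def)
  have U: "\<Union>\<beta> \<in> events"
    using \<beta> sets by (intro sets.countable_Union) auto
  have disj: "A \<inter> \<Union>\<beta> = {}"
  proof -
    have "A \<inter> B = {}" if "B \<in> \<beta>" for B
      using disjointD[OF partition_onD2[OF part] assms(4), of B] \<beta>(2) assms(5) that by auto
    then show ?thesis by auto
  qed
  have A: "A \<in> events"
    using assms(4) sets by auto
  have "prob (A \<union> \<Union>\<beta>) = prob A + prob (\<Union>\<beta>)"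
    using A U disj by (rule finite_measure_Union)
  then have "prob A + 1 \<le> 1"
    using \<beta>(3) prob_le_1[of "A \<union> \<Union>\<beta>"] by simp
  then show ?thesis
    using measure_nonneg[of M A] by linarith
qed

lemma shannon_entropy_eq:
  assumes "prob_space M" "measurable_partition M \<alpha>" "conull_subcollection M \<alpha> \<beta>"
  shows "shannon_entropy M \<alpha> = (\<Sum>\<^sub>\<infinity>A\<in>\<beta>. ennreal (- measure M A * ln (measure M A)))"
proof -
  define \<gamma> where "\<gamma> = (SOME \<beta>. conull_subcollection M \<alpha> \<beta>)"
  have \<gamma>: "conull_subcollection M \<alpha> \<gamma>"
    unfolding \<gamma>_def using assms(3) by (rule someI)
  have sub: "\<beta> \<subseteq> \<alpha>" "\<gamma> \<subseteq> \<alpha>"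
    using assms(3) \<gamma> by (auto simp: conull_subcollection_def)
  have "(\<Sum>\<^sub>\<infinity>A\<in>\<gamma>. ennreal (- measure M A * ln (measure M A))) =
        (\<Sum>\<^sub>\<infinity>A\<in>\<beta>. ennreal (- measure M A * ln (measure M A)))"
  proof (rule infsum_cong_neutral)
    fix A assume "A \<in> \<beta> - \<gamma>"
    then have "measure M A = 0"
      using sub by (intro conull_subcollection_null[OF assms(1,2) \<gamma>]) auto
    then show "ennreal (- measure M A * ln (measure M A)) = 0" by simp
  next
    fix A assume "A \<in> \<gamma> - \<beta>"
    then have "measure M A = 0"
      using sub by (intro conull_subcollection_null[OF assms]) auto
    then show "ennreal (- measure M A * ln (measure M A)) = 0" by simp
  qed simp
  moreover have "\<exists>\<beta>. conull_subcollection M \<alpha> \<beta>"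
    using assms(3) by blast
  ultimately show ?thesis
    unfolding shannon_entropy_def \<gamma>_def[symmetric] by simp
qed

end

theory Submission
  imports Defs
begin

text \<open>Give a class of measure about \<open>2\<^sup>-\<^sup>l\<close> a code word of \<open>l + 1\<close> bits. By finite entropy the sets
  \<open>B\<^sub>j\<close> of points whose code word has a \<open>j\<close>-th bit have summable measure; \<open>P\<^sub>j \<subseteq> B\<^sub>j\<close> is the set of
  points whose \<open>j\<close>-th bit is set. Choose \<open>J\<close> such that the \<open>B\<^sub>j\<close> with \<open>j \<ge> J\<close> have total measure at
  most 1. By ergodicity a greedy procedure matches these sets, one after the other, almost everywhere
  with disjoint subsets of the space, moving points by group elements. The pieces of the matching of
  \<open>B\<^sub>j\<close> are determined by the sets \<open>B\<^sub>i\<close>, \<open>J \<le> i \<le> j\<close>, and translations only. Mark the partner of a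
  point of \<open>B\<^sub>j\<close> with the two bits ``the point is in \<open>P\<^sub>j\<close>'' and ``the point is in \<open>B\<^bsub>j+1\<^esub>\<close>''. From
  \<open>B\<^sub>J\<close> and these two markings one recovers inductively all \<open>B\<^sub>j\<close> and \<open>P\<^sub>j\<close> with \<open>j \<ge> J\<close>, up to null
  sets; the finitely many earlier ones are put into the partition as they are.\<close>

section \<open>Translates of sets and complete invariant \<sigma>-algebras\<close>

context pmp_action
begin

sublocale prob_space M
  using standard by (simp add: standard_probability_space_def)

sublocale group G
  using group_hom by (simp add: group_hom_def)

lemma action_closed: "g \<in> carrier G \<Longrightarrow> x \<in> space M \<Longrightarrow> \<phi> g x \<in> space M"
  using element_image by blast

lemma action_inv_action: "g \<in> carrier G \<Longrightarrow> x \<in> space M \<Longrightarrow> \<phi> (inv g) (\<phi> g x) = x"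
  using orbit_sym_aux by blast

lemma action_action_inv: "g \<in> carrier G \<Longrightarrow> x \<in> space M \<Longrightarrow> \<phi> g (\<phi> (inv g) x) = x"
  using action_inv_action[of "inv g" x] by simp

lemma action_image_eq_vimage:
  assumes "g \<in> carrier G" "A \<subseteq> space M"
  shows "\<phi> g ` A = \<phi> (inv g) -` A \<inter> space M"
proof
  show "\<phi> g ` A \<subseteq> \<phi> (inv g) -` A \<inter> space M"
    using assms action_closed action_inv_action by (auto simp: subset_iff)
  show "\<phi> (inv g) -` A \<inter> space M \<subseteq> \<phi> g ` A"
    using assms action_action_inv by (auto simp: image_iff) (metis)
qed

lemma action_image_sets: "g \<in> carrier G \<Longrightarrow> A \<in> sets M \<Longrightarrow> \<phi> g ` A \<in> sets M"
  using measurable_sets[OF measurable_action[of "inv g"]]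
  by (simp add: action_image_eq_vimage sets.sets_into_space)

lemma emeasure_action_image:
  "g \<in> carrier G \<Longrightarrow> A \<in> sets M \<Longrightarrow> emeasure M (\<phi> g ` A) = emeasure M A"
  using measure_preserving[of "inv g"]
  by (simp add: action_image_eq_vimage sets.sets_into_space)

lemma measure_action_image:
  "g \<in> carrier G \<Longrightarrow> A \<in> sets M \<Longrightarrow> measure M (\<phi> g ` A) = measure M A"
  by (simp add: measure_def emeasure_action_image)

lemma action_image_comp:
  assumes "g \<in> carrier G" "h \<in> carrier G" "A \<subseteq> space M"
  shows "\<phi> g ` (\<phi> h ` A) = \<phi> (g \<otimes> h) ` A"
  unfolding image_image using assms by (intro image_cong) (auto simp: composition_rule subset_iff)

lemma action_one_image: "A \<subseteq> space M \<Longrightarrow> \<phi> \<one> ` A = A"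
  using id_eq_one by (metis image_cong image_ident restrict_apply' subsetD)

text \<open>Such a family models what an observer knows. Null sets are included so that recovery up
  to null sets becomes membership; the matching lemmas are used both for \<open>sets M\<close> and
  for the algebra of the new partition.\<close>

definition complete_invariant :: "'a set set \<Rightarrow> bool" where
  "complete_invariant F \<longleftrightarrow> sigma_algebra (space M) F \<and> F \<subseteq> sets M \<and> null_sets M \<subseteq> F \<and>
     (\<forall>g\<in>carrier G. \<forall>A\<in>F. \<phi> g ` A \<in> F)"

lemma complete_invariant_sets: "complete_invariant (sets M)"
  unfolding complete_invariant_def by (auto simp: action_image_sets sets.sigma_algebra_axioms)

definition completed_translates :: "'a set set \<Rightarrow> 'a set set" where
  "completed_translates \<alpha> =
     {B \<in> sets M. \<exists>B'\<in>translates_algebra G M \<phi> \<alpha>. emeasure M (sym_diff B B') = 0}"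

lemma generating_partition_iff_completed_translates:
  "generating_partition G M \<phi> \<alpha> \<longleftrightarrow>
     measurable_partition M \<alpha> \<and> completed_translates \<alpha> = sets M"
  unfolding generating_partition_def completed_translates_def by blast

lemma translates_algebra_subset_sets:
  assumes "\<alpha> \<subseteq> sets M"
  shows "translates_algebra G M \<phi> \<alpha> \<subseteq> sets M"
  unfolding translates_algebra_def
  using assms by (intro sets.sigma_sets_subset) (auto intro: action_image_sets)

lemma translates_algebra_invariant:
  assumes "\<alpha> \<subseteq> sets M" "g \<in> carrier G" "A \<in> translates_algebra G M \<phi> \<alpha>"
  shows "\<phi> g ` A \<in> translates_algebra G M \<phi> \<alpha>"
  using assms(3) unfolding translates_algebra_def
proof (induction rule: sigma_sets.induct)
  case (Basic a)
  then obtain h D where h: "a = \<phi> h ` D" "h \<in> carrier G" "D \<in> \<alpha>" by auto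
  then have "D \<subseteq> space M"
    using assms(1) sets.sets_into_space by blast
  then have "\<phi> g ` a = \<phi> (g \<otimes> h) ` D"
    using h action_image_comp[OF assms(2)] by simp
  then show ?case
    using h assms(2) by (intro sigma_sets.Basic) (use m_closed in blast)
next
  case Empty
  show ?case by (simp add: sigma_sets.Empty)
next
  case (Compl a)
  have "a \<subseteq> space M"
    using Compl translates_algebra_subset_sets[OF assms(1)] sets.sets_into_space
    unfolding translates_algebra_def by blast
  then have "\<phi> g ` (space M - a) = space M - \<phi> g ` a"
    using inj_on_image_set_diff[OF inj_prop[OF assms(2)], of "space M" a] surj_prop[OF assms(2)]
    by auto
  then show ?case using Compl by (simp add: sigma_sets.Compl)
next
  case (Union a)
  then show ?case by (simp add: image_UN sigma_sets.Union)
qed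

text \<open>Complements, countable unions and translations of approximating sets \<open>B'\<close>
  approximate the corresponding sets again, since null sets are stable under countable unions and
  translations. A null set is approximated by the empty set.\<close>

lemma complete_invariant_completed_translates:
  assumes "\<alpha> \<subseteq> sets M"
  shows "complete_invariant (completed_translates \<alpha>)"
proof -
  let ?T = "translates_algebra G M \<phi> \<alpha>"
  note TM = translates_algebra_subset_sets[OF assms]
  interpret T: sigma_algebra "space M" ?T
    unfolding translates_algebra_def using assms
    by (intro sigma_algebra_sigma_sets) (auto dest: sets.sets_into_space action_closed)
  have mem: "B \<in> completed_translates \<alpha> \<longleftrightarrow>
      B \<in> sets M \<and> (\<exists>B'\<in>?T. sym_diff B B' \<in> null_sets M)" for B
    using TM by (auto simp: completed_translates_def null_sets_def)
  have "sigma_algebra (space M) (completed_translates \<alpha>)"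
    unfolding sigma_algebra_iff2
  proof (intro conjI ballI allI impI)
    show "completed_translates \<alpha> \<subseteq> Pow (space M)"
      using sets.sets_into_space by (auto simp: completed_translates_def)
    show "{} \<in> completed_translates \<alpha>"
      unfolding mem by (auto intro!: bexI[of _ "{}"])
  next
    fix B assume B: "B \<in> completed_translates \<alpha>"
    then obtain B' where B': "B' \<in> ?T" "sym_diff B B' \<in> null_sets M" "B \<in> sets M"
      unfolding mem by blast
    have "sym_diff (space M - B) (space M - B') = sym_diff B B'"
      using B' sets.sets_into_space TM by blast
    then show "space M - B \<in> completed_translates \<alpha>"
      using B' unfolding mem by (auto intro!: bexI[of _ "space M - B'"])
  next
    fix A :: "nat \<Rightarrow> 'a set" assume A: "range A \<subseteq> completed_translates \<alpha>"
    then have "\<forall>i. \<exists>B'\<in>?T. sym_diff (A i) B' \<in> null_sets M"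
      unfolding mem by (meson mem rangeI subsetD)
    then obtain A' where A': "\<And>i. A' i \<in> ?T" "\<And>i. sym_diff (A i) (A' i) \<in> null_sets M"
      by metis
    have Am: "A i \<in> sets M" for i using A mem by blast
    have "(\<Union>i. sym_diff (A i) (A' i)) \<in> null_sets M"
      using A' by (intro null_sets_UN) auto
    moreover have "sym_diff (\<Union>i. A i) (\<Union>i. A' i) \<in> sets M"
      using Am A' TM by blast
    ultimately have "sym_diff (\<Union>i. A i) (\<Union>i. A' i) \<in> null_sets M"
      by (rule null_sets_subset) blast
    then show "(\<Union>i. A i) \<in> completed_translates \<alpha>"
      unfolding mem using Am A' by (auto intro!: bexI[of _ "\<Union>i. A' i"])
  qed
  moreover have "\<phi> g ` B \<in> completed_translates \<alpha>"
    if g: "g \<in> carrier G" and B: "B \<in> completed_translates \<alpha>" for g B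
  proof -
    obtain B' where B': "B' \<in> ?T" "sym_diff B B' \<in> null_sets M" "B \<in> sets M"
      using B unfolding mem by blast
    have sub: "B \<subseteq> space M" "B' \<subseteq> space M"
      using B' TM sets.sets_into_space by blast+
    have "sym_diff (\<phi> g ` B) (\<phi> g ` B') = \<phi> g ` sym_diff B B'"
      using inj_on_image_set_diff[OF inj_prop[OF g], of B B']
        inj_on_image_set_diff[OF inj_prop[OF g], of B' B] sub by (auto simp: image_Un)
    then have "sym_diff (\<phi> g ` B) (\<phi> g ` B') \<in> null_sets M"
      using B'(2) g by (auto simp: null_sets_def emeasure_action_image action_image_sets)
    then show ?thesis
      unfolding mem using B' g
      by (auto intro!: bexI[of _ "\<phi> g ` B'"] action_image_sets translates_algebra_invariant[OF assms])
  qed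
  moreover have "null_sets M \<subseteq> completed_translates \<alpha>"
    unfolding mem subset_iff by (auto intro!: bexI[of _ "{}"])
  ultimately show ?thesis
    unfolding complete_invariant_def by (auto simp: completed_translates_def)
qed

text \<open>Minimality of the completed algebra: to prove that a partition generates, it suffices to
  place a known generator inside its completed algebra.\<close>

lemma completed_translates_subset:
  assumes "complete_invariant F" "\<alpha> \<subseteq> F"
  shows "completed_translates \<alpha> \<subseteq> F"
proof
  interpret F: sigma_algebra "space M" F using assms(1) by (simp add: complete_invariant_def)
  fix B assume "B \<in> completed_translates \<alpha>"
  then obtain B' where B: "B \<in> sets M" "B' \<in> translates_algebra G M \<phi> \<alpha>"
      "emeasure M (sym_diff B B') = 0"
    unfolding completed_translates_def by blast
  have "translates_algebra G M \<phi> \<alpha> \<subseteq> F"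
    unfolding translates_algebra_def
    using assms by (intro F.sigma_sets_subset) (auto simp: complete_invariant_def)
  then have B': "B' \<in> F" "B' \<in> sets M"
    using B assms(1) unfolding complete_invariant_def by blast+
  have "sym_diff B B' \<in> null_sets M" using B B' by (auto simp: null_sets_def)
  then have "B - B' \<in> null_sets M" "B' - B \<in> null_sets M"
    using B B' by (auto intro: null_sets_subset)
  \<comment> \<open>\<open>B\<close> arises from \<open>B'\<close> by removing one null set and
    adding another.\<close>
  then have "(B' - (B' - B)) \<union> (B - B') \<in> F"
    using B' assms(1) unfolding complete_invariant_def by blast
  moreover have "(B' - (B' - B)) \<union> (B - B') = B" by blast
  ultimately show "B \<in> F" by simp
qed

lemma subset_completed_translates:
  assumes "\<alpha> \<subseteq> sets M"
  shows "\<alpha> \<subseteq> completed_translates \<alpha>"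
proof
  fix A assume A: "A \<in> \<alpha>"
  then have "A = \<phi> \<one> ` A"
    using assms sets.sets_into_space by (intro action_one_image[symmetric]) blast
  then have "A \<in> translates_algebra G M \<phi> \<alpha>"
    unfolding translates_algebra_def using A one_closed by (intro sigma_sets.Basic) blast
  then show "A \<in> completed_translates \<alpha>"
    using A assms unfolding completed_translates_def by (auto intro!: bexI[of _ A])
qed

section \<open>Greedy matching of two sets\<close>

definition translator where
  "translator = from_nat_into (carrier G)"

lemma translator_closed: "translator n \<in> carrier G"
  unfolding translator_def using one_closed by (intro from_nat_into) blast

text \<open>The greedy matching of \<open>B\<close> into \<open>C\<close>: at stage \<open>n\<close>, whatever is left of \<open>B\<close> and is sent by
  the \<open>n\<close>-th group element into what is left of \<open>C\<close> gets matched. The pair consists of the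
  unmatched parts of \<open>B\<close> and \<open>C\<close> before stage \<open>n\<close>.\<close>

primrec unmatched :: "'a set \<Rightarrow> 'a set \<Rightarrow> nat \<Rightarrow> 'a set \<times> 'a set" where
  "unmatched B C 0 = (B, C)"
| "unmatched B C (Suc n) =
     (let (b, c) = unmatched B C n; Z = b \<inter> \<phi> (inv translator n) ` c
      in (b - Z, c - \<phi> (translator n) ` Z))"

definition piece :: "'a set \<Rightarrow> 'a set \<Rightarrow> nat \<Rightarrow> 'a set" where
  "piece B C n = fst (unmatched B C n) \<inter> \<phi> (inv translator n) ` snd (unmatched B C n)"

definition piece_image :: "'a set \<Rightarrow> 'a set \<Rightarrow> nat \<Rightarrow> 'a set" where
  "piece_image B C n = \<phi> (translator n) ` piece B C n"

lemma unmatched_Suc: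
  "fst (unmatched B C (Suc n)) = fst (unmatched B C n) - piece B C n"
  "snd (unmatched B C (Suc n)) = snd (unmatched B C n) - piece_image B C n"
  by (simp_all add: piece_def piece_image_def Let_def split_beta)

declare unmatched.simps(2) [simp del]

lemma unmatched_eq:
  "fst (unmatched B C n) = B - (\<Union>i<n. piece B C i)"
  "snd (unmatched B C n) = C - (\<Union>i<n. piece_image B C i)"
  by (induction n) (auto simp: unmatched_Suc lessThan_Suc)

lemma piece_subset: "piece B C n \<subseteq> B"
  using unmatched_eq(1)[of B C n] unfolding piece_def by blast

lemma piece_image_subset_unmatched:
  assumes "C \<subseteq> space M"
  shows "piece_image B C n \<subseteq> snd (unmatched B C n)"
proof -
  have "snd (unmatched B C n) \<subseteq> space M"
    using assms unmatched_eq(2)[of B C n] by blast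
  then show ?thesis
    unfolding piece_image_def piece_def
    using action_action_inv[OF translator_closed[of n]] by (auto simp: subset_iff)
qed

lemma piece_image_subset: "C \<subseteq> space M \<Longrightarrow> piece_image B C n \<subseteq> C"
  using piece_image_subset_unmatched[of C B n] unmatched_eq(2)[of B C n] by blast

lemma disjoint_piece_image:
  assumes "C \<subseteq> space M"
  shows "disjoint_family (piece_image B C)"
proof -
  have "piece_image B C i \<inter> piece_image B C j = {}" if "i < j" for i j
    using that piece_image_subset_unmatched[OF assms, of B j] unmatched_eq(2)[of B C j] by blast
  then show ?thesis
    unfolding disjoint_family_on_def by (metis inf_commute linorder_neqE_nat)
qed

text \<open>Each stage uses only Boolean operations and translations, so whoever knows
  \<open>B\<close> and \<open>C\<close> can carry out the matching.\<close>

lemma unmatched_in_complete_invariant: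
  assumes "complete_invariant F" "B \<in> F" "C \<in> F"
  shows "fst (unmatched B C n) \<in> F \<and> snd (unmatched B C n) \<in> F"
proof (induction n)
  case 0
  then show ?case using assms by simp
next
  case (Suc n)
  interpret F: sigma_algebra "space M" F using assms by (simp add: complete_invariant_def)
  have inv: "\<phi> g ` A \<in> F" if "g \<in> carrier G" "A \<in> F" for g A
    using assms that by (simp add: complete_invariant_def)
  have "piece B C n \<in> F" "piece_image B C n \<in> F"
    unfolding piece_def piece_image_def using Suc translator_closed by (auto intro!: inv)
  then show ?case using Suc by (simp add: unmatched_Suc F.Diff)
qed

lemma piece_in_complete_invariant:
  assumes "complete_invariant F" "B \<in> F" "C \<in> F"
  shows "piece B C n \<in> F" "piece_image B C n \<in> F"
proof -
  interpret F: sigma_algebra "space M" F using assms by (simp add: complete_invariant_def)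
  have inv: "\<phi> g ` A \<in> F" if "g \<in> carrier G" "A \<in> F" for g A
    using assms that by (simp add: complete_invariant_def)
  show "piece B C n \<in> F" "piece_image B C n \<in> F"
    unfolding piece_def piece_image_def
    using unmatched_in_complete_invariant[OF assms, of n] translator_closed by (auto intro!: inv)
qed

text \<open>Each stage removes a piece from \<open>B\<close> and a translate of it, of equal
  measure, from \<open>C\<close>.\<close>

lemma measure_unmatched:
  assumes "B \<in> sets M" "C \<in> sets M"
  shows "measure M (snd (unmatched B C n)) =
    measure M C - measure M B + measure M (fst (unmatched B C n))"
proof (induction n)
  case 0
  then show ?case by simp
next
  case (Suc n)
  note S = complete_invariant_sets assms
  have "measure M (piece_image B C n) = measure M (piece B C n)"
    unfolding piece_image_def
    by (rule measure_action_image[OF translator_closed piece_in_complete_invariant(1)[OF S]])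
  moreover have "piece B C n \<subseteq> fst (unmatched B C n)"
    unfolding piece_def by blast
  moreover have "piece_image B C n \<subseteq> snd (unmatched B C n)"
    by (rule piece_image_subset_unmatched[OF sets.sets_into_space[OF assms(2)]])
  ultimately show ?case
    using Suc unmatched_in_complete_invariant[OF S, of n] piece_in_complete_invariant[OF S, of n]
    by (simp add: unmatched_Suc finite_measure_Diff)
qed

text \<open>The limit of the identity for finite stages, by continuity of the measure from
  above.\<close>

lemma measure_residue:
  assumes "B \<in> sets M" "C \<in> sets M"
  shows "measure M (C - (\<Union>n. piece_image B C n)) =
    measure M C - measure M B + measure M (B - (\<Union>n. piece B C n))"
proof -
  note S = complete_invariant_sets assms
  have "(\<lambda>n. measure M (fst (unmatched B C n))) \<longlonglongrightarrow> measure M (\<Inter>n. fst (unmatched B C n))"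
    using unmatched_in_complete_invariant[OF S]
    by (intro finite_Lim_measure_decseq decseq_SucI) (auto simp: unmatched_Suc)
  moreover have "(\<lambda>n. measure M (snd (unmatched B C n))) \<longlonglongrightarrow> measure M (\<Inter>n. snd (unmatched B C n))"
    using unmatched_in_complete_invariant[OF S]
    by (intro finite_Lim_measure_decseq decseq_SucI) (auto simp: unmatched_Suc)
  moreover have "(\<Inter>n. fst (unmatched B C n)) = B - (\<Union>n. piece B C n)"
    "(\<Inter>n. snd (unmatched B C n)) = C - (\<Union>n. piece_image B C n)"
    unfolding unmatched_eq by blast+
  ultimately have
    lim: "(\<lambda>n. measure M (fst (unmatched B C n))) \<longlonglongrightarrow> measure M (B - (\<Union>n. piece B C n))"
      "(\<lambda>n. measure M C - measure M B + measure M (fst (unmatched B C n)))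
        \<longlonglongrightarrow> measure M (C - (\<Union>n. piece_image B C n))"
    by (simp_all add: measure_unmatched[OF assms])
  show ?thesis
    by (rule LIMSEQ_unique[OF lim(2)]) (intro tendsto_intros lim(1))
qed

section \<open>Successive matchings and transferred markings\<close>

primrec available :: "(nat \<Rightarrow> 'a set) \<Rightarrow> nat \<Rightarrow> 'a set" where
  "available B 0 = space M"
| "available B (Suc j) = available B j - (\<Union>n. piece_image (B j) (available B j) n)"

text \<open>The partners of the matched points of all \<open>P j\<close>, collected in a single set.
  The pieces depend on \<open>B\<close> alone, so they can be computed without knowing
  \<open>P\<close>.\<close>

definition transferred :: "(nat \<Rightarrow> 'a set) \<Rightarrow> (nat \<Rightarrow> 'a set) \<Rightarrow> 'a set" where
  "transferred B P = (\<Union>j n. \<phi> (translator n) ` (piece (B j) (available B j) n \<inter> P j))"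

lemma available_subset_space: "available B j \<subseteq> space M"
  by (induction j) auto

lemma available_antimono: "i \<le> j \<Longrightarrow> available B j \<subseteq> available B i"
  by (induction j rule: dec_induct) auto

lemma available_sets:
  assumes "\<And>j. B j \<in> sets M"
  shows "available B j \<in> sets M"
  using piece_in_complete_invariant(2)[OF complete_invariant_sets assms]
  by (induction j) auto

lemma transferred_sets:
  assumes "\<And>j. B j \<in> sets M" "\<And>j. P j \<in> sets M"
  shows "transferred B P \<in> sets M"
  unfolding transferred_def
  using assms piece_in_complete_invariant(1)[OF complete_invariant_sets assms(1) available_sets[OF assms(1)]]
  by (intro sets.countable_UN) (auto intro!: action_image_sets translator_closed)

text \<open>Matching \<open>B i\<close> uses up at most its own measure as partners.\<close>

lemma measure_available:
  assumes "\<And>j. B j \<in> sets M"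
  shows "1 - (\<Sum>i<j. measure M (B i)) \<le> measure M (available B j)"
proof (induction j)
  case 0
  then show ?case by (simp add: prob_space)
next
  case (Suc j)
  then show ?case
    using measure_residue[OF assms[of j] available_sets[of B j, OF assms]]
      measure_nonneg[of M "B j - (\<Union>n. piece (B j) (available B j) n)"]
    unfolding available.simps sum.lessThan_Suc by linarith
qed

text \<open>Partners used for one set are no longer available for later sets; within one matching
  the piece images are disjoint.\<close>

lemma piece_image_available_disjoint:
  assumes "(i, m) \<noteq> (j, n)"
  shows "piece_image (B i) (available B i) m \<inter> piece_image (B j) (available B j) n = {}"
proof -
  have *: "piece_image (B i) (available B i) m \<inter> piece_image (B j) (available B j) n = {}"
    if "i < j" for i j m n
    using available_antimono[of "Suc i" j B] that
      piece_image_subset[OF available_subset_space, of "B j" B j n] by auto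
  show ?thesis
  proof (cases "i = j")
    case True
    then show ?thesis
      using assms disjoint_piece_image[OF available_subset_space, of "B j" B j]
      by (auto simp: disjoint_family_on_def)
  next
    case False
    then show ?thesis
      using *[of i j m n] *[of j i n m] by (cases "i < j") auto
  qed
qed

text \<open>Reads the marking back: the partner of a point belongs to no other piece image, so it is
  marked exactly if the point itself lies in \<open>P j\<close>.\<close>

lemma piece_Int_transferred:
  assumes "\<And>j. B j \<subseteq> space M"
  shows "piece (B j) (available B j) n \<inter> \<phi> (inv translator n) ` transferred B P =
    piece (B j) (available B j) n \<inter> P j"
proof (intro equalityI subsetI)
  fix x assume x: "x \<in> piece (B j) (available B j) n \<inter> P j"
  then have "x \<in> space M" using piece_subset assms by blast
  then have "x = \<phi> (inv translator n) (\<phi> (translator n) x)"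
    by (simp add: action_inv_action translator_closed)
  then show "x \<in> piece (B j) (available B j) n \<inter> \<phi> (inv translator n) ` transferred B P"
    using x unfolding transferred_def by blast
next
  fix x assume x: "x \<in> piece (B j) (available B j) n \<inter> \<phi> (inv translator n) ` transferred B P"
  then obtain y i m z where y: "x = \<phi> (inv translator n) y" "y = \<phi> (translator m) z"
      "z \<in> piece (B i) (available B i) m" "z \<in> P i"
    unfolding transferred_def by blast
  have sp: "x \<in> space M" "z \<in> space M" using x y piece_subset assms by blast+
  have yx: "y = \<phi> (translator n) x"
    using y sp by (simp add: action_closed action_action_inv translator_closed)
  have "y \<in> piece_image (B j) (available B j) n" "y \<in> piece_image (B i) (available B i) m"
    using x y yx unfolding piece_image_def by blast+
  then have "(i, m) = (j, n)"
    using piece_image_available_disjoint by blast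
  then show "x \<in> piece (B j) (available B j) n \<inter> P j"
    using x y sp by (simp add: action_inv_action translator_closed)
qed

end

section \<open>Ergodicity and recovery of the coded sets\<close>

context ergodic_pmp_action
begin

text \<open>No group element can move a point of the residue \<open>b\<close> of \<open>B\<close>
  into the residue \<open>c\<close> of \<open>C\<close>, since it would have been matched. By
  ergodicity the saturation of \<open>c\<close> is null or conull; either way \<open>b\<close> is
  null.\<close>

lemma residue_null:
  assumes "countable (carrier G)" "B \<in> sets M" "C \<in> sets M" "measure M B \<le> measure M C"
  shows "B - (\<Union>n. piece B C n) \<in> null_sets M"
proof -
  note S = complete_invariant_sets assms(2,3)
  define b where "b = B - (\<Union>n. piece B C n)"
  define c where "c = C - (\<Union>n. piece_image B C n)"
  have bc: "b \<in> sets M" "c \<in> sets M"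
    unfolding b_def c_def using piece_in_complete_invariant[OF S] assms by auto
  note sp = bc[THEN sets.sets_into_space]
  have le: "measure M b \<le> measure M c"
    using measure_residue[OF assms(2,3)] assms(4) by (simp add: b_def c_def)
  have apart: "\<phi> g x \<notin> c" if g: "g \<in> carrier G" and x: "x \<in> b" for g x
  proof
    assume gx: "\<phi> g x \<in> c"
    \<comment> \<open>Countability of the group makes the enumeration exhaust it, so every
      \<open>g\<close> has had its stage.\<close>
    obtain n where n: "g = translator n"
      unfolding translator_def using from_nat_into_surj[OF assms(1) g] by metis
    have "x \<in> fst (unmatched B C n)" "\<phi> g x \<in> snd (unmatched B C n)"
      using x gx unfolding unmatched_eq b_def c_def by blast+
    moreover have "x = \<phi> (inv translator n) (\<phi> g x)"
      using x sp g n by (auto simp: action_inv_action)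
    ultimately have "x \<in> piece B C n" unfolding piece_def by blast
    then show False using x unfolding b_def by blast
  qed
  define S where "S = (\<Union>g\<in>carrier G. \<phi> g ` c)"
  have SM: "S \<in> sets M"
    unfolding S_def using assms(1) bc action_image_sets by (intro sets.countable_UN') auto
  have sub: "\<phi> g ` S \<subseteq> S" if "g \<in> carrier G" for g
  proof -
    have "\<phi> g ` \<phi> h ` c \<subseteq> S" if "h \<in> carrier G" for h
      using action_image_comp[OF \<open>g \<in> carrier G\<close> that sp(2)] that \<open>g \<in> carrier G\<close>
      unfolding S_def by (metis UN_upper m_closed)
    then show ?thesis unfolding S_def image_UN by blast
  qed
  have "\<phi> g ` S = S" if g: "g \<in> carrier G" for g
  proof
    show "S \<subseteq> \<phi> g ` S"
    proof
      fix x assume x: "x \<in> S"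
      then have "\<phi> (inv g) x \<in> S" "\<phi> g (\<phi> (inv g) x) = x"
        using sub[of "inv g"] g SM[THEN sets.sets_into_space] by (auto simp: action_action_inv)
      then show "x \<in> \<phi> g ` S" by (metis imageI)
    qed
  qed (rule sub[OF g])
  then consider "measure M S = 0" | "measure M S = 1"
    using ergodic[OF SM] by blast
  then have "measure M b = 0"
  proof cases
    case 1
    \<comment> \<open>If \<open>S\<close> is null, so is \<open>c\<close>, and \<open>b\<close> is
      no larger than \<open>c\<close>.\<close>
    have "c \<subseteq> S"
      unfolding S_def using action_one_image[OF sp(2)] by (metis UN_upper one_closed)
    then have "measure M c \<le> 0"
      using finite_measure_mono[OF _ SM] 1 by metis
    then show ?thesis using le measure_nonneg[of M b] by linarith
  next
    case 2
    \<comment> \<open>A conull set disjoint from \<open>b\<close> leaves no mass for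
      \<open>b\<close>.\<close>
    have "b \<inter> S = {}"
    proof (rule ccontr)
      assume "b \<inter> S \<noteq> {}"
      then obtain g y where g: "g \<in> carrier G" "y \<in> c" "\<phi> g y \<in> b"
        unfolding S_def by blast
      then have "\<phi> (inv g) (\<phi> g y) \<in> c"
        using sp by (auto simp: action_inv_action)
      then show False using apart[of "inv g" "\<phi> g y"] g by auto
    qed
    then have "measure M (b \<union> S) = measure M b + 1"
      using 2 finite_measure_Union[OF bc(1) SM] by simp
    then show ?thesis using prob_le_1[of "b \<union> S"] measure_nonneg[of M b] by linarith
  qed
  then show ?thesis
    using bc by (simp add: b_def[symmetric] null_sets_def emeasure_eq_measure)
qed

context
  fixes B F
  assumes countable: "countable (carrier G)"
    and B: "\<And>j::nat. B j \<in> sets M"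
    and mass: "\<And>n. (\<Sum>j<n. measure M (B j)) \<le> 1"
    and F: "complete_invariant F"
begin

text \<open>\<open>Q j\<close> is a countable union of parts of the pieces, read off from translates
  of the marking, together with a null remainder.\<close>

lemma recover_transferred:
  assumes "B j \<in> F" "available B j \<in> F"
    and Q: "Q j \<in> sets M" "Q j \<subseteq> B j" and L: "transferred B Q \<in> F"
  shows "Q j \<in> F"
proof -
  interpret F: sigma_algebra "space M" F using F by (simp add: complete_invariant_def)
  let ?Z = "piece (B j) (available B j)"
  have Z: "?Z n \<in> F" for n
    using piece_in_complete_invariant(1)[OF F assms(1,2)] .
  then have Z_sets: "?Z n \<in> sets M" for n
    using F by (auto simp: complete_invariant_def)
  \<comment> \<open>The earlier sets have used up so little that \<open>B j\<close> still fits into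
    what is available, hence is matched almost everywhere.\<close>
  have "(\<Sum>i<j. measure M (B i)) + measure M (B j) \<le> 1"
    using mass[of "Suc j"] by simp
  then have "measure M (B j) \<le> measure M (available B j)"
    using measure_available[of B j, OF B] by linarith
  then have "B j - (\<Union>n. ?Z n) \<in> null_sets M"
    by (intro residue_null countable B available_sets)
  moreover have "Q j - (\<Union>n. ?Z n) \<in> sets M"
    using Q(1) Z_sets by (intro sets.Diff sets.countable_UN) auto
  ultimately have "Q j - (\<Union>n. ?Z n) \<in> null_sets M"
    by (rule null_sets_subset) (use Q in blast)
  then have "Q j - (\<Union>n. ?Z n) \<in> F"
    using F unfolding complete_invariant_def by blast
  moreover have "?Z n \<inter> Q j \<in> F" for n
  proof -
    have "\<phi> (inv translator n) ` transferred B Q \<in> F"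
      using F L translator_closed by (simp add: complete_invariant_def)
    then show ?thesis
      using Z piece_Int_transferred[of B j n Q] B sets.sets_into_space by (metis F.Int)
  qed
  ultimately have "(\<Union>n. ?Z n \<inter> Q j) \<union> (Q j - (\<Union>n. ?Z n)) \<in> F"
    by (intro F.Un F.countable_UN) auto
  moreover have "(\<Union>n. ?Z n \<inter> Q j) \<union> (Q j - (\<Union>n. ?Z n)) = Q j" by blast
  ultimately show ?thesis by simp
qed

lemma decode:
  assumes "\<And>j. P j \<in> sets M" "\<And>j. P j \<subseteq> B j" "\<And>j. B (Suc j) \<subseteq> B j"
    and "B 0 \<in> F" "transferred B P \<in> F" "transferred B (\<lambda>j. B (Suc j)) \<in> F"
  shows "B j \<in> F" "P j \<in> F"
proof -
  interpret F: sigma_algebra "space M" F using F by (simp add: complete_invariant_def)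
  \<comment> \<open>Knowing \<open>B j\<close> and \<open>available B j\<close> determines the
    matching of \<open>B j\<close>; its second marking yields \<open>B (Suc j)\<close>, and removing
    the partners yields the next available set.\<close>
  have *: "B j \<in> F \<and> available B j \<in> F" for j
  proof (induction j)
    case 0
    then show ?case using assms by simp
  next
    case (Suc j)
    then have "B (Suc j) \<in> F"
      using recover_transferred[of j "\<lambda>j. B (Suc j)"] assms B by blast
    moreover have "available B (Suc j) \<in> F"
      using Suc piece_in_complete_invariant(2)[OF F]
      unfolding available.simps by (intro F.Diff F.countable_UN) auto
    ultimately show ?case by blast
  qed
  then show "B j \<in> F" by blast
  show "P j \<in> F"
    using recover_transferred[of j P] * assms by blast
qed

end

end

section \<open>Finite partitions from finite families of sets\<close>

definition atoms :: "'a set \<Rightarrow> 'a set set \<Rightarrow> 'a set set" where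
  "atoms X \<S> = (\<lambda>x. {y \<in> X. \<forall>S\<in>\<S>. y \<in> S \<longleftrightarrow> x \<in> S}) ` X"

text \<open>An atom is determined by the subfamily \<open>T\<close> of the sets that contain
  it.\<close>

lemma finite_atoms:
  assumes "finite \<S>"
  shows "finite (atoms X \<S>)"
proof (rule finite_subset)
  show "atoms X \<S> \<subseteq> (\<lambda>T. {y \<in> X. \<forall>S\<in>\<S>. y \<in> S \<longleftrightarrow> S \<in> T}) ` Pow \<S>"
    unfolding atoms_def
  proof (rule image_subsetI)
    fix x
    have "{y \<in> X. \<forall>S\<in>\<S>. y \<in> S \<longleftrightarrow> x \<in> S} = {y \<in> X. \<forall>S\<in>\<S>. y \<in> S \<longleftrightarrow> S \<in> {S \<in> \<S>. x \<in> S}}"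
      by simp
    then show "{y \<in> X. \<forall>S\<in>\<S>. y \<in> S \<longleftrightarrow> x \<in> S} \<in>
        (\<lambda>T. {y \<in> X. \<forall>S\<in>\<S>. y \<in> S \<longleftrightarrow> S \<in> T}) ` Pow \<S>"
      by (rule image_eqI) simp
  qed
qed (use assms in simp)

lemma measurable_partition_atoms:
  assumes "finite \<S>" "\<S> \<subseteq> sets M"
  shows "measurable_partition M (atoms (space M) \<S>)"
  unfolding measurable_partition_def
proof
  show "partition_on (space M) (atoms (space M) \<S>)"
  proof (rule partition_onI)
    show "\<Union>(atoms (space M) \<S>) = space M" "{} \<notin> atoms (space M) \<S>"
      unfolding atoms_def by auto
    show "disjnt p q" if pq: "p \<in> atoms (space M) \<S>" "q \<in> atoms (space M) \<S>" "p \<noteq> q" for p q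
    proof (rule ccontr)
      obtain x y where p: "p = {z \<in> space M. \<forall>S\<in>\<S>. z \<in> S \<longleftrightarrow> x \<in> S}"
        and q: "q = {z \<in> space M. \<forall>S\<in>\<S>. z \<in> S \<longleftrightarrow> y \<in> S}"
        using pq(1,2) unfolding atoms_def by (elim imageE)
      assume "\<not> disjnt p q"
      then obtain z where "z \<in> p" "z \<in> q" unfolding disjnt_def by auto
      then have "\<And>S. S \<in> \<S> \<Longrightarrow> x \<in> S \<longleftrightarrow> y \<in> S" unfolding p q by simp
      then have "p = q" unfolding p q by simp
      then show False using pq(3) by simp
    qed
  qed
  have "{y \<in> space M. y \<in> S \<longleftrightarrow> x \<in> S} = (if x \<in> S then S else space M - S)"
    if "S \<in> \<S>" for S x
    using that assms(2) sets.sets_into_space by auto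
  then have "{y \<in> space M. y \<in> S \<longleftrightarrow> x \<in> S} \<in> sets M" if "S \<in> \<S>" for S x
    using that assms(2) by auto
  then have "{y \<in> space M. \<forall>S\<in>\<S>. y \<in> S \<longleftrightarrow> x \<in> S} \<in> sets M" for x
    using assms(1) by (intro sets.sets_Collect_finite_All) auto
  then show "atoms (space M) \<S> \<subseteq> sets M"
    unfolding atoms_def by blast
qed

lemma Union_atoms_subset:
  assumes "S \<in> \<S>" "S \<subseteq> X"
  shows "\<Union>{A \<in> atoms X \<S>. A \<subseteq> S} = S"
proof (intro equalityI subsetI)
  fix x assume x: "x \<in> S"
  define A where "A = {y \<in> X. \<forall>S\<in>\<S>. y \<in> S \<longleftrightarrow> x \<in> S}"
  have "x \<in> A" "A \<subseteq> S" using x assms by (auto simp: A_def)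
  moreover have "A \<in> atoms X \<S>"
    unfolding atoms_def A_def using x assms(2) by (intro imageI) auto
  ultimately show "x \<in> \<Union>{A \<in> atoms X \<S>. A \<subseteq> S}" by blast
qed blast

section \<open>Code words from finite entropy\<close>

lemma nn_integral_count_space_le_finite_sums:
  fixes f :: "'a \<Rightarrow> ennreal"
  assumes "countable A" "\<And>F. finite F \<Longrightarrow> F \<subseteq> A \<Longrightarrow> sum f F \<le> C"
  shows "(\<integral>\<^sup>+x. f x \<partial>count_space A) \<le> C"
proof (cases "A = {}")
  case False
  \<comment> \<open>Finite initial parts of an enumeration exhaust \<open>A\<close>, so monotone
    convergence applies.\<close>
  define F where "F n = from_nat_into A ` {..<n}" for n :: nat
  have F: "finite (F n)" "F n \<subseteq> A" for n
    using from_nat_into[OF False] by (auto simp: F_def)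
  have ind: "(SUP n. indicator (F n) x :: ennreal) = 1" if x: "x \<in> A" for x
  proof -
    obtain n where "x = from_nat_into A n" using from_nat_into_surj[OF assms(1) x] by metis
    then have "x \<in> F (Suc n)" by (auto simp: F_def)
    then have "(1::ennreal) \<le> (SUP n. indicator (F n) x)" by (intro SUP_upper2[of "Suc n"]) auto
    moreover have "(SUP n. indicator (F n) x) \<le> (1::ennreal)"
      by (intro SUP_least) (auto simp: indicator_def)
    ultimately show ?thesis by simp
  qed
  have "(\<integral>\<^sup>+x. f x \<partial>count_space A) = (\<integral>\<^sup>+x. (SUP n. f x * indicator (F n) x) \<partial>count_space A)"
    by (intro nn_integral_cong) (simp add: SUP_mult_left_ennreal[symmetric] ind)
  also have "\<dots> = (SUP n. \<integral>\<^sup>+x. f x * indicator (F n) x \<partial>count_space A)"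
    by (intro nn_integral_monotone_convergence_SUP)
      (auto simp: incseq_def le_fun_def F_def indicator_def)
  also have "\<dots> \<le> C"
  proof (rule SUP_least)
    fix n
    have "(\<integral>\<^sup>+x. f x * indicator (F n) x \<partial>count_space A) = (\<Sum>x\<in>F n. f x * indicator (F n) x)"
      using F by (intro nn_integral_count_space') (auto simp: indicator_def)
    also have "\<dots> = sum f (F n)" by (intro sum.cong) auto
    finally show "(\<integral>\<^sup>+x. f x * indicator (F n) x \<partial>count_space A) \<le> C"
      using assms(2)[OF F] by simp
  qed
  finally show ?thesis .
qed (simp add: nn_integral_empty)

text \<open>In the last clause \<open>l\<close> is the last bit position of the code word and
  \<open>c\<close> the set of positions whose bit is set. Bits are numbered from 0, so the word has
  \<open>l + 1\<close> bits. Null classes get no word.\<close>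

lemma (in prob_space) finite_entropy_code:
  assumes part: "measurable_partition M \<alpha>" and ent: "shannon_entropy M \<alpha> < \<infinity>"
  obtains B P :: "nat \<Rightarrow> 'a set"
  where "\<And>j. B j \<in> sets M" "\<And>j. P j \<in> sets M" "\<And>j. P j \<subseteq> B j" "\<And>j. B (Suc j) \<subseteq> B j"
    "summable (\<lambda>j. measure M (B j))"
    "\<And>A. A \<in> \<alpha> \<Longrightarrow> measure M A \<noteq> 0 \<Longrightarrow> \<exists>l. \<exists>c\<subseteq>{..l}.
       A = (B l - B (Suc l)) - (\<Union>j\<in>{..l} - c. P j) - (\<Union>j\<in>c. B l - P j)"
proof -
  obtain \<beta> where \<beta>: "conull_subcollection M \<alpha> \<beta>"
  proof -
    have "\<exists>\<beta>. conull_subcollection M \<alpha> \<beta>"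
    proof (rule ccontr)
      assume "\<not> ?thesis"
      then show False using ent by (simp add: shannon_entropy_def)
    qed
    then show thesis using that by blast
  qed
  define H where "H = (\<Sum>\<^sub>\<infinity>A\<in>\<beta>. ennreal (- measure M A * ln (measure M A)))"
  have H: "H < \<infinity>"
    using ent shannon_entropy_eq[OF prob_space_axioms part \<beta>] by (simp add: H_def)
  define K where "K = {A \<in> \<alpha>. measure M A \<noteq> 0}"
  have K_\<beta>: "K \<subseteq> \<beta>"
    using conull_subcollection_null[OF prob_space_axioms part \<beta>] by (auto simp: K_def)
  then have countable_K: "countable K"
    using \<beta> by (auto simp: conull_subcollection_def intro: countable_subset)
  have K_sets: "A \<in> sets M" if "A \<in> K" for A
    using that part by (auto simp: K_def measurable_partition_def)
  have K_disj: "A = A'" if "A \<in> K" "A' \<in> K" "x \<in> A" "x \<in> A'" for A A' x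
    using that disjointD[OF partition_onD2, of "space M" \<alpha> A A'] part
    unfolding K_def measurable_partition_def by blast
  have K_pos: "0 < measure M A" if "A \<in> K" for A
    using that by (simp add: K_def zero_less_measure_iff)
  have K_sum: "(\<Sum>A\<in>D. measure M A) = measure M (\<Union>A\<in>D. A)" if D: "D \<subseteq> K" "finite D" for D
  proof -
    have "disjoint_family_on (\<lambda>A. A) D"
      unfolding disjoint_family_on_def
    proof (intro ballI impI)
      fix A A' assume "A \<in> D" "A' \<in> D" "A \<noteq> A'"
      then show "A \<inter> A' = {}" using K_disj[of A A'] D by blast
    qed
    then show ?thesis
      using D K_sets by (intro finite_measure_finite_Union[symmetric]) auto
  qed
  \<comment> \<open>This puts the measure of \<open>A\<close> between \<open>2^-(lev A + 1)\<close>
    and \<open>2^-(lev A)\<close>.\<close>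
  define lev where "lev A = nat \<lfloor>- log 2 (measure M A)\<rfloor>" for A
  have log_nonneg: "0 \<le> - log 2 (measure M A)" if "A \<in> K" for A
    using K_pos[OF that] by simp
  have lev_le: "real (lev A) \<le> - log 2 (measure M A)" if "A \<in> K" for A
    using log_nonneg[OF that] unfolding lev_def by simp
  have lev_gt: "1 / 2 ^ Suc (lev A) \<le> measure M A" if "A \<in> K" for A
  proof -
    have "- log 2 (measure M A) \<le> real (Suc (lev A))"
      using log_nonneg[OF that] unfolding lev_def by linarith
    then have "2 powr (- real (Suc (lev A))) \<le> 2 powr log 2 (measure M A)"
      by (intro powr_mono) auto
    then show ?thesis
      using K_pos[OF that] by (simp add: powr_minus powr_realpow field_simps del: power_Suc of_nat_Suc)
  qed
  define L where "L i = {A \<in> K. lev A = i}" for i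
  \<comment> \<open>Each class of level \<open>i\<close> has measure at least
    \<open>2^-(i+1)\<close>, so there are at most as many as there are subsets of
    \<open>{..i}\<close>; distinct words of \<open>i + 1\<close> bits therefore suffice.\<close>
  have L_card: "card D \<le> 2 ^ Suc i" if D: "D \<subseteq> L i" "finite D" for D i
  proof -
    have "real (card D) * (1 / 2 ^ Suc i) = (\<Sum>A\<in>D. 1 / 2 ^ Suc i)" by simp
    also have "\<dots> \<le> (\<Sum>A\<in>D. measure M A)"
      using D lev_gt by (intro sum_mono) (auto simp: L_def)
    also have "\<dots> = measure M (\<Union>A\<in>D. A)"
      using D by (intro K_sum) (auto simp: L_def)
    also have "\<dots> \<le> 1" by simp
    finally have "real (card D) \<le> 2 ^ Suc i" by (simp add: field_simps del: power_Suc)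
    then show ?thesis
      by (metis of_nat_le_iff of_nat_numeral of_nat_power)
  qed
  have L_fin: "finite (L i)" for i
    using finite_if_finite_subsets_card_bdd[of "L i" "2 ^ Suc i"] L_card by blast
  have "\<exists>f. f ` L i \<subseteq> Pow {..i} \<and> inj_on f (L i)" for i
    using L_card[OF order_refl L_fin] L_fin by (intro card_le_inj) (auto simp: card_Pow)
  then obtain f where f: "\<And>i. f i ` L i \<subseteq> Pow {..i}" "\<And>i. inj_on (f i) (L i)"
    by metis
  define code where "code A = f (lev A) A" for A
  have code_le: "code A \<subseteq> {..lev A}" if "A \<in> K" for A
    using f(1)[of "lev A"] that by (auto simp: code_def L_def)
  have code_inj: "A = A'" if "A \<in> K" "A' \<in> K" "lev A = lev A'" "code A = code A'" for A A'
    using that f(2)[of "lev A"] by (auto simp: code_def L_def inj_on_def)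
  define B where "B j = \<Union>{A \<in> K. j \<le> lev A}" for j
  define P where "P j = \<Union>{A \<in> K. j \<in> code A}" for j
  show thesis
  proof
    show "B j \<in> sets M" "P j \<in> sets M" for j
      unfolding B_def P_def using countable_K K_sets
      by (auto intro!: sets.countable_Union intro: countable_subset[OF _ countable_K])
    show "P j \<subseteq> B j" for j
      unfolding B_def P_def using code_le by fastforce
    show "B (Suc j) \<subseteq> B j" for j
      unfolding B_def by fastforce
  next
    fix A assume "A \<in> \<alpha>" "measure M A \<noteq> 0"
    then have A: "A \<in> K" by (simp add: K_def)
    \<comment> \<open>The classes are disjoint, so the membership pattern of a point shows the level
      and the word of its class.\<close>
    have mem: "(x \<in> B j \<longleftrightarrow> j \<le> lev A) \<and> (x \<in> P j \<longleftrightarrow> j \<in> code A)" if "A \<in> K" "x \<in> A" for A x j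
      using that K_disj unfolding B_def P_def by blast
    have "A = (B (lev A) - B (Suc (lev A))) - (\<Union>j\<in>{..lev A} - code A. P j)
        - (\<Union>j\<in>code A. B (lev A) - P j)" (is "A = ?R")
    proof (intro equalityI subsetI)
      fix x assume "x \<in> A"
      then show "x \<in> ?R" using mem[OF A] by auto
    next
      fix x assume x: "x \<in> ?R"
      then obtain A' where A': "A' \<in> K" "x \<in> A'" unfolding B_def by blast
      have l: "lev A' = lev A" using x mem[OF A'] by auto
      moreover have "code A' = code A"
        using x mem[OF A'] code_le[OF A] code_le[OF A'(1)] l by auto
      ultimately show "x \<in> A" using code_inj[OF A'(1) A] A' by simp
    qed
    then show "\<exists>l. \<exists>c\<subseteq>{..l}.
       A = (B l - B (Suc l)) - (\<Union>j\<in>{..l} - c. P j) - (\<Union>j\<in>c. B l - P j)"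
      using code_le[OF A] by blast
  next
    \<comment> \<open>An upper bound for the measure of \<open>A\<close> times its word length; the
      divisor \<open>ln 2\<close> turns nats into bits. Summed over \<open>K\<close>, it gives at
      most 1 plus the entropy in bits.\<close>
    define h where "h A = ennreal (measure M A + - measure M A * ln (measure M A) / ln 2)" for A
    have "(\<Sum>A\<in>D. h A) \<le> 1 + ennreal (1 / ln 2) * H" if D: "finite D" "D \<subseteq> K" for D
    proof -
      have nonneg: "0 \<le> - measure M A * ln (measure M A)" for A
        by (cases "measure M A = 0") (auto simp: mult_nonneg_nonpos zero_less_measure_iff)
      have "h A = ennreal (measure M A) +
          ennreal (1 / ln 2) * ennreal (- measure M A * ln (measure M A))" for A
      proof -
        have "h A = ennreal (measure M A + 1 / ln 2 * (- measure M A * ln (measure M A)))"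
          by (simp add: h_def)
        also have "\<dots> = ennreal (measure M A) +
            ennreal (1 / ln 2 * (- measure M A * ln (measure M A)))"
          by (intro ennreal_plus mult_nonneg_nonneg[OF _ nonneg]) auto
        also have "ennreal (1 / ln 2 * (- measure M A * ln (measure M A))) =
            ennreal (1 / ln 2) * ennreal (- measure M A * ln (measure M A))"
          by (intro ennreal_mult nonneg) simp
        finally show ?thesis .
      qed
      then have "(\<Sum>A\<in>D. h A) = (\<Sum>A\<in>D. ennreal (measure M A)) +
          (\<Sum>A\<in>D. ennreal (1 / ln 2) * ennreal (- measure M A * ln (measure M A)))"
        by (simp add: sum.distrib)
      also have "(\<Sum>A\<in>D. ennreal (measure M A)) = ennreal (measure M (\<Union>A\<in>D. A))"
        using K_sum[OF D(2,1)] by (simp add: sum_ennreal)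
      also have "\<dots> \<le> 1" by simp
      also have "(\<Sum>A\<in>D. ennreal (1 / ln 2) * ennreal (- measure M A * ln (measure M A))) =
          ennreal (1 / ln 2) * (\<Sum>A\<in>D. ennreal (- measure M A * ln (measure M A)))"
        by (simp add: sum_distrib_left)
      also have "(\<Sum>A\<in>D. ennreal (- measure M A * ln (measure M A))) \<le> H"
        unfolding H_def using D K_\<beta>
        by (subst nonneg_infsum_complete) (auto intro!: SUP_upper)
      finally show ?thesis by (simp add: add_mono mult_left_mono)
    qed
    then have int_h: "(\<integral>\<^sup>+A. h A \<partial>count_space K) \<le> 1 + ennreal (1 / ln 2) * H"
      using countable_K by (intro nn_integral_count_space_le_finite_sums)
    have B_int: "emeasure M (B j) = (\<integral>\<^sup>+A. emeasure M A * indicator {..lev A} j \<partial>count_space K)" for j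
    proof -
      have "B j = (\<Union>A\<in>K. if j \<le> lev A then A else {})" by (auto simp: B_def)
      also have "emeasure M \<dots> = (\<integral>\<^sup>+A. emeasure M (if j \<le> lev A then A else {}) \<partial>count_space K)"
        using countable_K K_sets K_disj
        by (intro emeasure_UN_countable) (auto simp: disjoint_family_on_def)
      also have "\<dots> = (\<integral>\<^sup>+A. emeasure M A * indicator {..lev A} j \<partial>count_space K)"
        by (intro nn_integral_cong) auto
      finally show ?thesis .
    qed
    \<comment> \<open>Exchanging the summations counts each class once for every bit of its word,
      that is, \<open>lev A + 1\<close> times.\<close>
    have "(\<Sum>j. emeasure M (B j)) =
        (\<integral>\<^sup>+A. (\<Sum>j. emeasure M A * indicator {..lev A} j) \<partial>count_space K)"
      unfolding B_int by (intro nn_integral_suminf[symmetric]) auto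
    also have "\<dots> \<le> (\<integral>\<^sup>+A. h A \<partial>count_space K)"
    proof (intro nn_integral_mono)
      fix A assume "A \<in> space (count_space K)"
      then have A: "A \<in> K" by simp
      have "(\<Sum>j. emeasure M A * indicator {..lev A} j) =
          (\<Sum>j\<in>{..lev A}. emeasure M A * indicator {..lev A} j)"
        by (intro suminf_finite) auto
      also have "\<dots> = ennreal (measure M A * (1 + real (lev A)))"
        by (simp add: emeasure_eq_measure ennreal_mult' ennreal_of_nat_eq_real_of_nat mult.commute)
      also have "\<dots> \<le> h A"
      proof -
        have "measure M A * real (lev A) \<le> measure M A * (- log 2 (measure M A))"
          using lev_le[OF A] by (intro mult_left_mono) auto
        then show ?thesis
          unfolding h_def by (intro ennreal_leI) (simp add: log_def algebra_simps)
      qed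
      finally show "(\<Sum>j. emeasure M A * indicator {..lev A} j) \<le> h A" .
    qed
    also note int_h
    also have "1 + ennreal (1 / ln 2) * H < \<infinity>"
      using H by (simp add: ennreal_mult_less_top)
    finally have "(\<Sum>j. ennreal (measure M (B j))) \<noteq> \<infinity>"
      by (simp add: emeasure_eq_measure)
    then show "summable (\<lambda>j. measure M (B j))"
      by (intro summable_suminf_not_top) (auto simp: infinity_ennreal_def)
  qed
qed

section \<open>Assembly of the finite generator\<close>

theorem theorem1p1:
  fixes G :: "('g, 'b) monoid_scheme"
    and M :: "'a measure"
    and \<phi> :: "'g \<Rightarrow> 'a \<Rightarrow> 'a"
    and \<alpha> :: "'a set set"
  assumes "ergodic_pmp_action G M \<phi>"
    and "countable (carrier G)"
    and "generating_partition G M \<phi> \<alpha>"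
    and "shannon_entropy M \<alpha> < \<infinity>"
  shows "\<exists>\<beta>. generating_partition G M \<phi> \<beta> \<and> finite \<beta>"
proof -
  interpret ergodic_pmp_action G M \<phi> by fact
  have part: "measurable_partition M \<alpha>" and gen: "completed_translates \<alpha> = sets M"
    using assms(3) by (simp_all add: generating_partition_iff_completed_translates)
  obtain B P :: "nat \<Rightarrow> 'a set" where B: "\<And>j. B j \<in> sets M" and P: "\<And>j. P j \<in> sets M"
    and PB: "\<And>j. P j \<subseteq> B j" and B_Suc: "\<And>j. B (Suc j) \<subseteq> B j"
    and summable: "summable (\<lambda>j. measure M (B j))"
    and code: "\<And>A. A \<in> \<alpha> \<Longrightarrow> measure M A \<noteq> 0 \<Longrightarrow> \<exists>l. \<exists>c\<subseteq>{..l}.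
       A = (B l - B (Suc l)) - (\<Union>j\<in>{..l} - c. P j) - (\<Union>j\<in>c. B l - P j)"
    using finite_entropy_code[OF part assms(4)] by blast
  obtain J where J: "norm (\<Sum>j. measure M (B (j + J))) < 1"
    using suminf_exist_split[OF _ summable, of 1] by auto
  define B' where "B' j = B (j + J)" for j
  define P' where "P' j = P (j + J)" for j
  have mass: "(\<Sum>j<n. measure M (B' j)) \<le> 1" for n
  proof -
    have "(\<Sum>j<n. measure M (B' j)) \<le> (\<Sum>j. measure M (B' j))"
      unfolding B'_def using summable by (intro sum_le_suminf) (auto intro: summable_ignore_initial_segment)
    then show ?thesis using J by (simp add: B'_def)
  qed
  \<comment> \<open>\<open>B J\<close> is included because decoding starts from \<open>B' 0\<close>;
    \<open>P J\<close> is not, since it equals \<open>P' 0\<close> and is recovered from the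
    marking.\<close>
  define \<S> where "\<S> = B ` {..J} \<union> P ` {..<J} \<union>
    {transferred B' P', transferred B' (\<lambda>j. B' (Suc j))}"
  have S: "finite \<S>" "\<S> \<subseteq> sets M"
    using B P by (auto simp: \<S>_def B'_def P'_def intro!: transferred_sets)
  define \<beta> where "\<beta> = atoms (space M) \<S>"
  have \<beta>: "finite \<beta>" "measurable_partition M \<beta>"
    using S by (simp_all add: \<beta>_def finite_atoms measurable_partition_atoms)
  then have \<beta>_sets: "\<beta> \<subseteq> sets M" by (simp add: measurable_partition_def)
  define F where "F = completed_translates \<beta>"
  have F: "complete_invariant F"
    unfolding F_def by (rule complete_invariant_completed_translates[OF \<beta>_sets])
  interpret F: sigma_algebra "space M" F using F by (simp add: complete_invariant_def)
  have \<beta>F: "\<beta> \<subseteq> F"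
    unfolding F_def by (rule subset_completed_translates[OF \<beta>_sets])
  have SF: "S \<in> F" if "S \<in> \<S>" for S
  proof -
    have "\<Union>{A \<in> \<beta>. A \<subseteq> S} \<in> F"
      using \<beta>(1) \<beta>F by (intro F.finite_Union) auto
    moreover have "S \<subseteq> space M"
      using that S(2) sets.sets_into_space by blast
    ultimately show ?thesis
      using Union_atoms_subset[OF that] unfolding \<beta>_def by simp
  qed
  have dec: "B' j \<in> F" "P' j \<in> F" for j
  proof -
    have "B' 0 \<in> F"
      by (rule SF) (simp add: \<S>_def B'_def)
    moreover have "transferred B' P' \<in> F" "transferred B' (\<lambda>j. B' (Suc j)) \<in> F"
      by (rule SF, simp add: \<S>_def)+
    moreover have "B' i \<in> sets M" "P' i \<in> sets M" "P' i \<subseteq> B' i" "B' (Suc i) \<subseteq> B' i" for i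
      using B P PB B_Suc by (simp_all add: B'_def P'_def)
    ultimately show "B' j \<in> F" "P' j \<in> F"
      using decode[OF assms(2) _ mass F, of P' j] by blast+
  qed
  have BF: "B j \<in> F" for j
    using dec(1)[of "j - J"] SF[of "B j"] by (cases "j \<le> J") (auto simp: B'_def \<S>_def)
  have PF: "P j \<in> F" for j
    using dec(2)[of "j - J"] SF[of "P j"] by (cases "j < J") (auto simp: P'_def \<S>_def)
  have "\<alpha> \<subseteq> F"
  proof
    fix A assume A: "A \<in> \<alpha>"
    show "A \<in> F"
    \<comment> \<open>Null classes lie in \<open>F\<close> by completeness; every other class is a
      finite Boolean combination of the decoded sets.\<close>
    proof (cases "measure M A = 0")
      case True
      then have "A \<in> null_sets M"
        using A part by (auto simp: null_sets_def emeasure_eq_measure measurable_partition_def)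
      then show ?thesis using F by (auto simp: complete_invariant_def)
    next
      case False
      obtain l c where c: "c \<subseteq> {..l}"
        and eq: "A = (B l - B (Suc l)) - (\<Union>j\<in>{..l} - c. P j) - (\<Union>j\<in>c. B l - P j)"
        using code[OF A False] by blast
      have "finite c" using c finite_subset by blast
      then show ?thesis
        unfolding eq using BF PF by (intro F.Diff F.finite_UN) auto
    qed
  qed
  then have "sets M \<subseteq> F"
    using completed_translates_subset[OF F \<open>\<alpha> \<subseteq> F\<close>] gen by simp
  then have "completed_translates \<beta> = sets M"
    using F unfolding F_def complete_invariant_def by blast
  then show ?thesis
    using \<beta> by (auto simp: generating_partition_iff_completed_translates)
qed

end
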